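(* Let $q, p \in \mathbb{N}$ with $q \geq p$, and let $x^0 \in \mathbb{R}^n$. Let $f : \mathbb{R}^n \to \mathbb{R}$ have a max-representation of order $q$, and assume that the sublevel set $\{ x \in \mathbb{R}^n : f(x) \leq f(x^0) \}$ is bounded. Let $(x^j)_j$ be the sequence generated by the trust-region bundle method (described in the context) with initial point $x^0$, model order $q$, exponent $p$, vanishing sequences $(\Delta_j)_j, (\tau_j)_j \subseteq \mathbb{R}^{>0}$, and parameters $\sigma \in (0,1)$, $c > 0$. Let $x^*$ be an accumulation point of $(x^j)_j$ such that property (P) holds for $p$ and $x^*$, i.e., there are an open neighborhood $U \subseteq \mathbb{R}^n$ of $x^*$ and a constant $C > 0$ such that $\Lambda^p(x,\Delta) \geq C$ for all $x \in U$ and $\Delta > 0$ with $x^* \notin \bar{B}_\Delta(x)$. Then $x^* \in \bar{B}_{\Delta_j}(x^j)$ for infinitely many $j \in \mathbb{N}$.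
   Context: Notation: $\mathbb{N} = \{1,2,\dots\}$, $\|\cdot\|$ is the Euclidean norm, $\bar{B}_\Delta(x) = \{ y \in \mathbb{R}^n : \| y - x \| \leq \Delta \}$. A sequence in $\mathbb{R}^{>0}$ is vanishing if it converges to $0$. Max-representation of order $q$: there are a (nonempty) compact topological space $S$ and $(q+1)$-times continuously differentiable functions $f_s : \mathbb{R}^n \to \mathbb{R}$, $s \in S$ (selection functions), such that $f(x) = \max_{s \in S} f_s(x)$ for all $x \in \mathbb{R}^n$, and $f_s(x)$ and all partial derivatives of $f_s$ at $x$ up to order $q+1$ depend continuously on $(s,x) \in S \times \mathbb{R}^n$. The active set at $x$ is $A(x) = \{ s \in S : f_s(x) = f(x) \}$. For $x \in \mathbb{R}^n$, $\Delta > 0$, $p \in \mathbb{N}$: $\Lambda^p(x,\Delta) = \dfrac{f(x) - f(z^*(x,\Delta))}{\Delta^p}$, where $z^*(x,\Delta) \in \arg\min_{z \in \bar{B}_\Delta(x)} f(z)$. Oracle: for each $x \in \mathbb{R}^n$ one has the value $f(x)$ and, for some $s(x) \in A(x)$, the derivatives up to order $q$ of $f_{s(x)}$ at $x$. The Taylor polynomial of order $q$ of $f_s$ at $y$ is $T^q f_s(z,y) = \sum_{m=0}^q \frac{1}{m!} D^m f_s(y)(z-y)^m$, where $D^0 f_s(y)(v)^0 = f_s(y)$ and $D^m f_s(y)(v)^m = \sum_{i_1=1}^n \cdots \sum_{i_m=1}^n \partial_{i_1}\cdots\partial_{i_m} f_s(y) v_{i_1}\cdots v_{i_m}$. For a nonempty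 finite set $W \subseteq \mathbb{R}^n$, the $q$-order cutting-plane model is $\mathcal{T}^{q,W}(z) = \max_{y \in W} T^q f_{s(y)}(z,y)$. Let $\bar{z}^{q,W}(x,\Delta)$ denote a solution of $\min_{z \in \bar{B}_\Delta(x)} \mathcal{T}^{q,W}(z)$. Subroutine (computation of $W$) for input $x$, $\Delta > 0$, and a finite nonempty $W^1 \subseteq \bar{B}_\Delta(x)$, with parameters $\sigma \in (0,1)$, $c > 0$: for $i = 1,2,\dots$, compute $\bar{z}^{W^i} = \bar{z}^{q,W^i}(x,\Delta)$; if $f(\bar{z}^{W^i}) - \mathcal{T}^{q,W^i}(\bar{z}^{W^i}) \leq \min(\Delta^{q+\sigma}, c)$, stop and return $W = W^i$; otherwise set $W^{i+1} = W^i \cup \{\bar{z}^{W^i}\}$. (It is known that this subroutine terminates for every $x$ and $\Delta$.) Trust-region bundle method: Given the initial point $x^{1,0} = x^0$, vanishing sequences $(\Delta_j)_j, (\tau_j)_j \subseteq \mathbb{R}^{>0}$, $p, q \in \mathbb{N}$, $\sigma \in (0,1)$, $c > 0$. For $j = 1,2,\dots$: for $i = 0,1,\dots$: compute $W_{j,i} \subseteq \bar{B}_{\Delta_j}(x^{j,i})$ via the subroutine with input $x = x^{j,i}$, $\Delta = \Delta_j$, $W^1 = \{x^{j,i}\}$, and set $\bar{z}^{j,i} = \bar{z}^{q,W_{j,i}}(x^{j,i},\Delta_j)$ (the solution for which the stopping criterion of the subroutine holds); if $(f(x^{j,i}) - f(\bar{z}^{j,i}))/\Delta_j^p < \tau_j$,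 break the $i$-loop, otherwise set $x^{j,i+1} = \bar{z}^{j,i}$. After the $i$-loop is broken, set $x^{j+1,0} = x^{j,i}$ and $x^j = x^{j,i}$ (for the last index $i$). *)

theory Defs
  imports "HOL-Analysis.Analysis"
begin

section \<open>Partial derivatives and Taylor polynomials\<close>

text \<open>The value is meaningful only where \<open>g\<close> is differentiable; below it is only used for
  sufficiently often differentiable functions.\<close>

definition partial_deriv :: "'n::finite \<Rightarrow> (real^'n \<Rightarrow> real) \<Rightarrow> real^'n \<Rightarrow> real" where
  "partial_deriv i g x = frechet_derivative g (at x) (axis i 1)"

text \<open>\<open>iter_partial [i\<^sub>1, \<dots>, i\<^sub>m] g\<close> is the partial derivative
  \<open>\<partial>\<^bsub>i\<^sub>1\<^esub> \<cdots> \<partial>\<^bsub>i\<^sub>m\<^esub> g\<close>.\<close>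

definition iter_partial :: "'n::finite list \<Rightarrow> (real^'n \<Rightarrow> real) \<Rightarrow> real^'n \<Rightarrow> real" where
  "iter_partial is g = foldr partial_deriv is g"

primrec cont_differentiable :: "nat \<Rightarrow> (real^'n::finite \<Rightarrow> real) \<Rightarrow> bool" where
  "cont_differentiable 0 g \<longleftrightarrow> continuous_on UNIV g"
| "cont_differentiable (Suc k) g \<longleftrightarrow>
     (\<forall>x. g differentiable (at x)) \<and> (\<forall>i. cont_differentiable k (partial_deriv i g))"

definition deriv_form :: "nat \<Rightarrow> (real^'n::finite \<Rightarrow> real) \<Rightarrow> real^'n \<Rightarrow> real^'n \<Rightarrow> real" where
  "deriv_form m g y v =
     (\<Sum>is\<in>{is :: 'n list. length is = m}. iter_partial is g y * (\<Prod>i\<leftarrow>is. v $ i))"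

definition taylor_poly :: "nat \<Rightarrow> (real^'n::finite \<Rightarrow> real) \<Rightarrow> real^'n \<Rightarrow> real^'n \<Rightarrow> real" where
  "taylor_poly q g z y = (\<Sum>m=0..q. 1 / fact m * deriv_form m g y (z - y))"


section \<open>Max-representations\<close>

definition max_representation ::
  "nat \<Rightarrow> 's topology \<Rightarrow> ('s \<Rightarrow> real^'n::finite \<Rightarrow> real) \<Rightarrow> (real^'n \<Rightarrow> real) \<Rightarrow> bool" where
  "max_representation q S F f \<longleftrightarrow>
     compact_space S \<and> topspace S \<noteq> {} \<and>
     (\<forall>s\<in>topspace S. cont_differentiable (q + 1) (F s)) \<and>
     (\<forall>x. (\<exists>s\<in>topspace S. F s x = f x) \<and> (\<forall>s\<in>topspace S. F s x \<le> f x)) \<and>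
     (\<forall>is. length is \<le> q + 1 \<longrightarrow>
        continuous_map (prod_topology S euclidean) euclideanreal
          (\<lambda>(s, x). iter_partial is (F s) x))"

definition active_set ::
  "'s topology \<Rightarrow> ('s \<Rightarrow> real^'n::finite \<Rightarrow> real) \<Rightarrow> (real^'n \<Rightarrow> real) \<Rightarrow> real^'n \<Rightarrow> 's set" where
  "active_set S F f x = {s \<in> topspace S. F s x = f x}"


section \<open>The growth quotient and property (P)\<close>

definition Lambda_quot :: "(real^'n::finite \<Rightarrow> real) \<Rightarrow> nat \<Rightarrow> real^'n \<Rightarrow> real \<Rightarrow> real" where
  "Lambda_quot f p x \<Delta> = (f x - f (arg_min_on f (cball x \<Delta>))) / \<Delta> ^ p"

definition property_P :: "(real^'n::finite \<Rightarrow> real) \<Rightarrow> nat \<Rightarrow> real^'n \<Rightarrow> bool" where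
  "property_P f p xs \<longleftrightarrow>
     (\<exists>U C. open U \<and> xs \<in> U \<and> C > 0 \<and>
        (\<forall>x\<in>U. \<forall>\<Delta>>0. xs \<notin> cball x \<Delta> \<longrightarrow> Lambda_quot f p x \<Delta> \<ge> C))"


section \<open>The cutting-plane model and the computation of its base points\<close>

text \<open>Here and below, \<open>sel y\<close> is the active index \<open>s(y)\<close> whose derivatives the oracle returns
  at \<open>y\<close>.\<close>

definition cp_model ::
  "nat \<Rightarrow> ('s \<Rightarrow> real^'n::finite \<Rightarrow> real) \<Rightarrow> (real^'n \<Rightarrow> 's) \<Rightarrow> (real^'n) set \<Rightarrow> real^'n \<Rightarrow> real" where
  "cp_model q F sel W z = Max ((\<lambda>y. taylor_poly q (F (sel y)) z y) ` W)"

definition cp_solution ::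
  "nat \<Rightarrow> ('s \<Rightarrow> real^'n::finite \<Rightarrow> real) \<Rightarrow> (real^'n \<Rightarrow> 's) \<Rightarrow>
   real^'n \<Rightarrow> real \<Rightarrow> (real^'n) set \<Rightarrow> real^'n \<Rightarrow> bool" where
  "cp_solution q F sel x \<Delta> W z \<longleftrightarrow> is_arg_min (cp_model q F sel W) (\<lambda>z. z \<in> cball x \<Delta>) z"

definition cp_accurate ::
  "(real^'n::finite \<Rightarrow> real) \<Rightarrow> nat \<Rightarrow> ('s \<Rightarrow> real^'n \<Rightarrow> real) \<Rightarrow> (real^'n \<Rightarrow> 's) \<Rightarrow>
   real \<Rightarrow> real \<Rightarrow> real \<Rightarrow> (real^'n) set \<Rightarrow> real^'n \<Rightarrow> bool" where
  "cp_accurate f q F sel \<sigma> c \<Delta> W z \<longleftrightarrow>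
     f z - cp_model q F sel W z \<le> min (\<Delta> powr (real q + \<sigma>)) c"

text \<open>The sets \<open>W\<^sup>i\<close> that the subroutine started with \<open>W1\<close> can produce. The solution of the
  subproblem need not be unique, so runs are described by a relation that admits any solution.\<close>

inductive subroutine_reaches ::
  "(real^'n::finite \<Rightarrow> real) \<Rightarrow> nat \<Rightarrow> ('s \<Rightarrow> real^'n \<Rightarrow> real) \<Rightarrow> (real^'n \<Rightarrow> 's) \<Rightarrow>
   real \<Rightarrow> real \<Rightarrow> real^'n \<Rightarrow> real \<Rightarrow> (real^'n) set \<Rightarrow> (real^'n) set \<Rightarrow> bool"
  for f q F sel \<sigma> c x \<Delta> W1 where
  init: "subroutine_reaches f q F sel \<sigma> c x \<Delta> W1 W1"
| step: "\<lbrakk>subroutine_reaches f q F sel \<sigma> c x \<Delta> W1 W; cp_solution q F sel x \<Delta> W z;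
          \<not> cp_accurate f q F sel \<sigma> c \<Delta> W z\<rbrakk>
         \<Longrightarrow> subroutine_reaches f q F sel \<sigma> c x \<Delta> W1 (W \<union> {z})"

text \<open>\<open>W\<close> is a possible return value of the subroutine, and \<open>z\<close> is the solution at which its
  stopping criterion was satisfied.\<close>

definition subroutine_returns ::
  "(real^'n::finite \<Rightarrow> real) \<Rightarrow> nat \<Rightarrow> ('s \<Rightarrow> real^'n \<Rightarrow> real) \<Rightarrow> (real^'n \<Rightarrow> 's) \<Rightarrow>
   real \<Rightarrow> real \<Rightarrow> real^'n \<Rightarrow> real \<Rightarrow> (real^'n) set \<Rightarrow> (real^'n) set \<Rightarrow> real^'n \<Rightarrow> bool" where
  "subroutine_returns f q F sel \<sigma> c x \<Delta> W1 W z \<longleftrightarrow>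
     subroutine_reaches f q F sel \<sigma> c x \<Delta> W1 W \<and> cp_solution q F sel x \<Delta> W z \<and>
     cp_accurate f q F sel \<sigma> c \<Delta> W z"


section \<open>The trust-region bundle method\<close>

text \<open>\<open>x\<close> is a sequence \<open>(x\<^sup>j)\<close>, \<open>j \<ge> 1\<close>, generated by the method (index 0 is unused), with
  \<open>X j i\<close>, \<open>W j i\<close>, \<open>Z j i\<close> for the iterates, base point sets and model minimizers.
  \<open>brk j i\<close> is the break test of the inner loop, so \<open>LEAST i. brk j i\<close> is the last inner index,
  and values beyond it are unconstrained. Termination of the inner loops is deliberately not
  part of the definition: for \<open>f\<close> bounded below it holds automatically, since every inner step
  decreases \<open>f\<close> by at least \<open>\<tau> j * \<Delta> j ^ p\<close>.\<close>

definition trust_region_bundle_sequence ::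
  "(real^'n::finite \<Rightarrow> real) \<Rightarrow> nat \<Rightarrow> nat \<Rightarrow> ('s \<Rightarrow> real^'n \<Rightarrow> real) \<Rightarrow> (real^'n \<Rightarrow> 's) \<Rightarrow>
   real \<Rightarrow> real \<Rightarrow> (nat \<Rightarrow> real) \<Rightarrow> (nat \<Rightarrow> real) \<Rightarrow> real^'n \<Rightarrow> (nat \<Rightarrow> real^'n) \<Rightarrow> bool" where
  "trust_region_bundle_sequence f q p F sel \<sigma> c \<Delta> \<tau> x0 x \<longleftrightarrow>
     (\<exists>(X :: nat \<Rightarrow> nat \<Rightarrow> real^'n) W Z brk.
        (\<forall>j i. brk j i \<longleftrightarrow> (f (X j i) - f (Z j i)) / \<Delta> j ^ p < \<tau> j) \<and>
        X 1 0 = x0 \<and>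
        (\<forall>j\<ge>1.
           (\<forall>i. (\<forall>k<i. \<not> brk j k) \<longrightarrow>
              subroutine_returns f q F sel \<sigma> c (X j i) (\<Delta> j) {X j i} (W j i) (Z j i) \<and>
              (\<not> brk j i \<longrightarrow> X j (i + 1) = Z j i)) \<and>
           x j = X j (LEAST i. brk j i) \<and>
           X (j + 1) 0 = x j))"

end

theory Submission
  imports Defs
begin

text \<open>Along the outer iterates, the growth quotient \<open>\<Lambda>\<^sup>p(x\<^sup>j, \<Delta>\<^sub>j)\<close> tends to 0, whereas
  property (P) keeps it above a positive constant at every iterate near \<open>x\<^sup>*\<close> whose trust region
  misses \<open>x\<^sup>*\<close>. If only finitely many trust regions contained \<open>x\<^sup>*\<close>, a subsequence converging to
  \<open>x\<^sup>*\<close> would contradict this.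

  The quotient vanishes by the following estimate. Let \<open>z\<close> be the last model minimizer at
  \<open>x\<^sup>j\<close>, let \<open>T\<close> be its model, and let \<open>y\<close> minimize \<open>f\<close> over the trust region. Then
  \<open>f(x\<^sup>j) - f(y)\<close> is the sum of
  \<^item> \<open>f(x\<^sup>j) - f(z)\<close>, which the break test of the inner loop puts below \<open>\<tau>\<^sub>j \<Delta>\<^sub>j\<^sup>p\<close>;
  \<^item> \<open>f(z) - T(z)\<close>, which the subroutine makes at most \<open>\<Delta>\<^sub>j powr (q + \<sigma>)\<close>;
  \<^item> \<open>T(z) - T(y)\<close>, which is nonpositive since \<open>z\<close> minimizes \<open>T\<close>;
  \<^item> \<open>T(y) - f(y)\<close>, which is at most \<open>L \<Delta>\<^sub>j ^ (q + 1)\<close> by Taylor's theorem.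

  As \<open>q \<ge> p\<close>, each of these bounds is \<open>o(\<Delta>\<^sub>j\<^sup>p)\<close>. The constant \<open>L\<close> does not depend on \<open>j\<close>: the method
  never leaves the bounded sublevel set of \<open>x\<^sup>0\<close>, so all points involved lie in one compact ball,
  and the derivatives of order \<open>q + 1\<close> are bounded there uniformly over the compact index
  space (\<open>cp_model_upper_bound\<close>). The argument needs the inner loops to stop; they do because each
  further step lowers \<open>f\<close> by a fixed amount, while \<open>f\<close> is bounded below on the sublevel set
  (\<open>trust_region_bundle_step\<close>).\<close>

section \<open>Taylor expansion in several variables\<close>

lemma cont_differentiable_iter_partial:
  "cont_differentiable (k + length is) g \<Longrightarrow> cont_differentiable k (iter_partial is g)"
proof (induction "is" arbitrary: k)
  case Nil
  then show ?case by (simp add: iter_partial_def)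
next
  case (Cons i "is")
  then have "cont_differentiable (Suc k) (iter_partial is g)"
    using Cons.IH[of "Suc k"] by simp
  then show ?case by (simp add: iter_partial_def)
qed

lemma cont_differentiable_imp_continuous_on:
  "cont_differentiable k g \<Longrightarrow> continuous_on A g"
  by (cases k)
    (auto intro: continuous_on_subset differentiable_imp_continuous_on
      simp: differentiable_on_def differentiable_at_withinI)

lemma differentiable_along_line:
  fixes g :: "real^'n::finite \<Rightarrow> real"
  assumes "g differentiable (at (y + t *\<^sub>R v))"
  shows "((\<lambda>t. g (y + t *\<^sub>R v)) has_real_derivative
           (\<Sum>i\<in>UNIV. v $ i * partial_deriv i g (y + t *\<^sub>R v))) (at t)"
proof -
  define D where "D = frechet_derivative g (at (y + t *\<^sub>R v))"
  have D: "(g has_derivative D) (at (y + t *\<^sub>R v))"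
    using assms frechet_derivative_works unfolding D_def by blast
  then interpret D: bounded_linear D by (rule has_derivative_bounded_linear)
  have "D v = D (\<Sum>i\<in>UNIV. v $ i *\<^sub>R axis i 1)"
    using basis_expansion[of v] by (simp add: scalar_mult_eq_scaleR)
  also have "\<dots> = (\<Sum>i\<in>UNIV. v $ i * partial_deriv i g (y + t *\<^sub>R v))"
    by (simp add: D.sum D.scaleR partial_deriv_def flip: D_def)
  finally have Dv: "D v = (\<Sum>i\<in>UNIV. v $ i * partial_deriv i g (y + t *\<^sub>R v))" .
  have "((\<lambda>t. g (y + t *\<^sub>R v)) has_derivative (\<lambda>h. D (h *\<^sub>R v))) (at t)"
    by (rule has_derivative_compose[where f = "\<lambda>t. y + t *\<^sub>R v", OF _ D])
      (auto intro!: derivative_eq_intros)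
  then show ?thesis
    by (simp add: has_field_derivative_def D.scaleR Dv mult_commute_abs)
qed

text \<open>Splitting off the outermost of the \<open>m + 1\<close> partial derivatives turns the form of order
  \<open>m + 1\<close> into a sum of directional derivatives, the shape in which the chain rule produces it.\<close>

lemma deriv_form_Suc:
  fixes g :: "real^'n::finite \<Rightarrow> real"
  shows "deriv_form (Suc m) g y v =
    (\<Sum>is\<in>{is :: 'n list. length is = m}.
       (\<Sum>i\<in>UNIV. v $ i * partial_deriv i (iter_partial is g) y) * (\<Prod>i\<leftarrow>is. v $ i))"
proof -
  have "{is :: 'n list. length is = Suc m} = (\<lambda>(is, i). i # is) ` ({is. length is = m} \<times> UNIV)"
    using lists_length_Suc_eq[of UNIV m] by simp
  moreover have "inj_on (\<lambda>(is, i). i # is) ({is :: 'n list. length is = m} \<times> UNIV)"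
    by (auto simp: inj_on_def)
  ultimately have "deriv_form (Suc m) g y v =
      (\<Sum>(is, i)\<in>{is :: 'n list. length is = m} \<times> UNIV.
         iter_partial (i # is) g y * (\<Prod>i\<leftarrow>i # is. v $ i))"
    unfolding deriv_form_def by (simp only: sum.reindex o_def case_prod_unfold)
  also have "\<dots> = (\<Sum>is\<in>{is :: 'n list. length is = m}. \<Sum>i\<in>UNIV.
      (v $ i * partial_deriv i (iter_partial is g) y) * (\<Prod>i\<leftarrow>is. v $ i))"
    unfolding sum.cartesian_product[symmetric]
    by (intro sum.cong refl) (simp add: iter_partial_def)
  finally show ?thesis by (simp add: sum_distrib_right)
qed

text \<open>The forms \<open>deriv_form m\<close> are thus the successive derivatives of \<open>t \<mapsto> g (y + t *\<^sub>R v)\<close>,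
  which reduces the multivariate expansion to Maclaurin's formula in one variable.\<close>

lemma deriv_form_along_line:
  fixes g :: "real^'n::finite \<Rightarrow> real"
  assumes "cont_differentiable k g" and "m < k"
  shows "((\<lambda>t. deriv_form m g (y + t *\<^sub>R v) v) has_real_derivative
           deriv_form (Suc m) g (y + t *\<^sub>R v) v) (at t)"
proof -
  have "iter_partial is g differentiable (at x)" if "length is = m" for "is" x
  proof -
    have "k = Suc (k - Suc m) + length is"
      using assms(2) that by simp
    then have "cont_differentiable (Suc (k - Suc m)) (iter_partial is g)"
      using assms(1) cont_differentiable_iter_partial by metis
    then show ?thesis by simp
  qed
  then show ?thesis
    unfolding deriv_form_Suc unfolding deriv_form_def
    by (intro DERIV_sum DERIV_cmult_right differentiable_along_line) auto
qed

text \<open>The form has \<open>CARD('n) ^ m\<close> summands, one for each list of \<open>m\<close> indices, and each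
  coordinate of \<open>v\<close> is at most \<open>norm v\<close>.\<close>

lemma deriv_form_bound:
  fixes g :: "real^'n::finite \<Rightarrow> real"
  assumes "\<And>is. length is = m \<Longrightarrow> \<bar>iter_partial is g y\<bar> \<le> M"
  shows "\<bar>deriv_form m g y v\<bar> \<le> real CARD('n) ^ m * M * norm v ^ m"
proof -
  have prod: "\<bar>\<Prod>i\<leftarrow>is. v $ i\<bar> \<le> norm v ^ length is" for "is" :: "'n list"
    by (induction "is") (auto simp: abs_mult intro!: mult_mono component_le_norm_cart)
  have "\<bar>deriv_form m g y v\<bar> \<le> (\<Sum>is\<in>{is :: 'n list. length is = m}. M * norm v ^ m)"
    unfolding deriv_form_def
  proof (rule sum_abs[THEN order_trans], rule sum_mono)
    fix "is" :: "'n list"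
    assume "is \<in> {is. length is = m}"
    then show "\<bar>iter_partial is g y * (\<Prod>i\<leftarrow>is. v $ i)\<bar> \<le> M * norm v ^ m"
      using assms[of "is"] prod[of "is"] by (auto simp: abs_mult intro!: mult_mono)
  qed
  also have "\<dots> = real CARD('n) ^ m * M * norm v ^ m"
    using card_lists_length_eq[of "UNIV :: 'n set" m] by simp
  finally show ?thesis .
qed

text \<open>Maclaurin's formula with Lagrange remainder for \<open>t \<mapsto> g (y + t *\<^sub>R v)\<close> between
  \<open>t = 0\<close> and \<open>t = 1\<close>; the intermediate point lies on the segment from \<open>y\<close> to \<open>z\<close>, hence in
  \<open>K\<close>. The factor \<open>1 / fact (q + 1)\<close> is estimated by 1.\<close>

lemma taylor_poly_remainder:
  fixes g :: "real^'n::finite \<Rightarrow> real"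
  assumes g: "cont_differentiable (q + 1) g"
    and K: "convex K" "y \<in> K" "z \<in> K"
    and M: "\<And>is x. length is = q + 1 \<Longrightarrow> x \<in> K \<Longrightarrow> \<bar>iter_partial is g x\<bar> \<le> M"
  shows "\<bar>g z - taylor_poly q g z y\<bar> \<le> real CARD('n) ^ (q + 1) * M * norm (z - y) ^ (q + 1)"
proof -
  define v where "v = z - y"
  let ?d = "\<lambda>m t. deriv_form m g (y + t *\<^sub>R v) v"
  have "\<exists>t. 0 < t \<and> t < 1 \<and> g (y + 1 *\<^sub>R v) =
      (\<Sum>m<q + 1. ?d m 0 / fact m * 1 ^ m) + ?d (q + 1) t / fact (q + 1) * 1 ^ (q + 1)"
    using deriv_form_along_line[OF g, of _ y v]
    by (intro Maclaurin) (auto simp: deriv_form_def[of 0] iter_partial_def)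
  then obtain t where t: "0 < t" "t < 1"
    and eq: "g z = (\<Sum>m<q + 1. ?d m 0 / fact m) + ?d (q + 1) t / fact (q + 1)"
    by (auto simp: v_def)
  have "(\<Sum>m<q + 1. ?d m 0 / fact m) = taylor_poly q g z y"
    unfolding taylor_poly_def v_def by (intro sum.cong) auto
  with eq have "\<bar>g z - taylor_poly q g z y\<bar> = \<bar>?d (q + 1) t\<bar> / fact (q + 1)"
    by simp
  also have "\<dots> \<le> \<bar>?d (q + 1) t\<bar>"
    using fact_ge_1[of "q + 1", where 'a = real] mult_left_mono[of 1 "fact (q + 1)" "\<bar>?d (q + 1) t\<bar>"]
    by (simp add: divide_le_eq del: fact_Suc)
  also have "\<dots> \<le> real CARD('n) ^ (q + 1) * M * norm v ^ (q + 1)"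
  proof (rule deriv_form_bound)
    have "y + t *\<^sub>R v = (1 - t) *\<^sub>R y + t *\<^sub>R z" by (simp add: v_def algebra_simps)
    then have "y + t *\<^sub>R v \<in> K"
      using K t by (simp add: convexD_alt)
    then show "\<bar>iter_partial is g (y + t *\<^sub>R v)\<bar> \<le> M" if "length is = q + 1" for "is"
      using M that by blast
  qed
  finally show ?thesis by (simp add: v_def)
qed

section \<open>Max-representations\<close>

text \<open>For each of the finitely many index lists, the partial derivative is a continuous function
  on the compact space \<open>S \<times> K\<close>.\<close>

lemma max_representation_partials_bounded:
  fixes F :: "'s \<Rightarrow> real^'n::finite \<Rightarrow> real"
  assumes rep: "max_representation q S F f" and K: "compact K" and m: "m \<le> q + 1"
  obtains M where "\<And>s is x. s \<in> topspace S \<Longrightarrow> length is = m \<Longrightarrow> x \<in> K \<Longrightarrow>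
    \<bar>iter_partial is (F s) x\<bar> \<le> M"
proof -
  have "\<exists>B. \<forall>s\<in>topspace S. \<forall>x\<in>K. \<bar>iter_partial is (F s) x\<bar> \<le> B" if "length is = m" for "is"
  proof -
    have "compactin (prod_topology S euclidean) (topspace S \<times> K)"
      using rep K by (simp add: max_representation_def compactin_Times flip: compact_space_def)
    moreover have "continuous_map (prod_topology S euclidean) euclideanreal
        (\<lambda>(s, x). iter_partial is (F s) x)"
      using rep m that by (simp add: max_representation_def)
    ultimately have "compact ((\<lambda>(s, x). iter_partial is (F s) x) ` (topspace S \<times> K))"
      using image_compactin by fastforce
    then have "bounded ((\<lambda>(s, x). iter_partial is (F s) x) ` (topspace S \<times> K))"
      by (rule compact_imp_bounded)
    then obtain B where "\<forall>r \<in> (\<lambda>(s, x). iter_partial is (F s) x) ` (topspace S \<times> K). \<bar>r\<bar> \<le> B"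
      unfolding bounded_real by blast
    then show ?thesis by auto
  qed
  then obtain B where B: "\<And>is s x. length is = m \<Longrightarrow> s \<in> topspace S \<Longrightarrow> x \<in> K \<Longrightarrow>
      \<bar>iter_partial is (F s) x\<bar> \<le> B is"
    by metis
  let ?I = "{is :: 'n list. length is = m}"
  have fin: "finite ?I"
    using finite_lists_length_eq[of "UNIV :: 'n set" m] by simp
  show thesis
  proof
    fix s x and "is" :: "'n list"
    assume "s \<in> topspace S" "length is = m" "x \<in> K"
    then have "\<bar>iter_partial is (F s) x\<bar> \<le> B is" by (simp add: B)
    also have "\<dots> \<le> Max (B ` ?I)" using fin \<open>length is = m\<close> by auto
    finally show "\<bar>iter_partial is (F s) x\<bar> \<le> Max (B ` ?I)" .
  qed
qed

text \<open>A supremum of continuous functions is lower semicontinuous. Concretely, the limit \<open>z\<close> of a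
  minimizing sequence satisfies \<open>F s z \<le> Inf (f ` K)\<close> for every \<open>s\<close>, and one of these values is
  \<open>f z\<close>. Besides bounding \<open>f\<close> below, this gives \<open>arg_min_on\<close> its intended meaning in
  \<open>Lambda_quot\<close>.\<close>

lemma max_representation_attains_inf:
  fixes F :: "'s \<Rightarrow> real^'n::finite \<Rightarrow> real"
  assumes rep: "max_representation q S F f" and K: "compact K" "K \<noteq> {}"
  obtains z where "is_arg_min f (\<lambda>z. z \<in> K) z"
proof -
  have cont: "continuous_on K (F s)" if "s \<in> topspace S" for s
    using rep that cont_differentiable_imp_continuous_on unfolding max_representation_def by blast
  have le: "F s x \<le> f x" if "s \<in> topspace S" for s x
    using rep that unfolding max_representation_def by blast
  obtain s0 where s0: "s0 \<in> topspace S" using rep unfolding max_representation_def by blast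
  obtain b where b: "b \<in> K" "\<forall>x\<in>K. F s0 b \<le> F s0 x"
    using continuous_attains_inf[OF K cont[OF s0]] by blast
  have bdd: "bdd_below (f ` K)"
    using b le[OF s0] by (intro bdd_belowI2[of _ "F s0 b"]) (meson order_trans)
  define a where "a = Inf (f ` K)"
  have "\<exists>z. z \<in> K \<and> f z < a + inverse (real (Suc n))" for n
    using cInf_less_iff[of "f ` K" "a + inverse (real (Suc n))"] K(2) bdd unfolding a_def by auto
  then obtain Z where Z: "\<And>n. Z n \<in> K" "\<And>n. f (Z n) < a + inverse (real (Suc n))" by metis
  obtain z r where z: "z \<in> K" "strict_mono r" "(Z \<circ> r) \<longlonglongrightarrow> z"
    using K(1) Z(1) unfolding compact_def by meson
  have lim: "(\<lambda>n. a + inverse (real (Suc (r n)))) \<longlonglongrightarrow> a"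
    using tendsto_add[OF tendsto_const LIMSEQ_subseq_LIMSEQ[OF LIMSEQ_inverse_real_of_nat z(2)]]
    by (simp add: o_def)
  have "F s z \<le> a" if s: "s \<in> topspace S" for s
  proof (rule LIMSEQ_le[OF _ lim])
    show "(\<lambda>n. F s (Z (r n))) \<longlonglongrightarrow> F s z"
      using cont[OF s] z Z(1) unfolding continuous_on_sequentially by (auto simp: o_def)
    show "\<exists>N. \<forall>n\<ge>N. F s (Z (r n)) \<le> a + inverse (real (Suc (r n)))"
      using le[OF s] Z(2) by (meson less_imp_le order_trans)
  qed
  moreover obtain s where "s \<in> topspace S" "F s z = f z"
    using rep unfolding max_representation_def by blast
  ultimately have "f z \<le> a" by metis
  moreover have "a \<le> f y" if "y \<in> K" for y
    unfolding a_def using that bdd by (simp add: cInf_lower)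
  ultimately have "is_arg_min f (\<lambda>z. z \<in> K) z"
    using z(1) unfolding is_arg_min_def by (meson leD order_trans)
  then show thesis by (rule that)
qed

section \<open>Accuracy of the cutting-plane model\<close>

lemma subroutine_reaches_base_points:
  assumes "subroutine_reaches f q F sel \<sigma> c x \<Delta> W1 W"
    and "finite W1" "W1 \<noteq> {}" "W1 \<subseteq> cball x \<Delta>"
  shows "finite W \<and> W \<noteq> {} \<and> W \<subseteq> cball x \<Delta>"
  using assms(1)
  by induction (use assms in \<open>auto simp: cp_solution_def is_arg_min_def\<close>)

text \<open>Each Taylor polynomial in the model exceeds its selection function, and hence \<open>f\<close>, by at
  most the remainder, and two points of the trust region are at most \<open>2 * \<Delta>\<close> apart. It is
  essential that \<open>L\<close> is uniform in the trust region and in the base points.\<close>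

lemma cp_model_upper_bound:
  fixes F :: "'s \<Rightarrow> real^'n::finite \<Rightarrow> real"
  assumes rep: "max_representation q S F f" and sel: "\<And>y. sel y \<in> topspace S"
    and K: "compact K"
  obtains L where "\<And>x \<Delta> W z. finite W \<Longrightarrow> W \<noteq> {} \<Longrightarrow> W \<subseteq> cball x \<Delta> \<Longrightarrow> z \<in> cball x \<Delta> \<Longrightarrow>
      cball x \<Delta> \<subseteq> K \<Longrightarrow> cp_model q F sel W z \<le> f z + L * \<Delta> ^ (q + 1)"
proof -
  obtain M where M: "\<And>s is x. s \<in> topspace S \<Longrightarrow> length is = q + 1 \<Longrightarrow> x \<in> K \<Longrightarrow>
      \<bar>iter_partial is (F s) x\<bar> \<le> M"
    using max_representation_partials_bounded[OF rep K order_refl] by metis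
  define L where "L = real CARD('n) ^ (q + 1) * \<bar>M\<bar> * 2 ^ (q + 1)"
  show thesis
  proof
    fix x \<Delta> W and z :: "real^'n"
    assume W: "finite W" "W \<noteq> {}" "W \<subseteq> cball x \<Delta>"
      and z: "z \<in> cball x \<Delta>" and K: "cball x \<Delta> \<subseteq> K"
    have "taylor_poly q (F (sel y)) z y \<le> f z + L * \<Delta> ^ (q + 1)" if "y \<in> W" for y
    proof -
      have y: "y \<in> cball x \<Delta>" using W that by blast
      have "dist z y \<le> dist x z + dist x y"
        by (metis dist_commute dist_triangle)
      then have "norm (z - y) \<le> 2 * \<Delta>"
        using y z by (simp add: dist_norm)
      then have "norm (z - y) ^ (q + 1) \<le> (2 * \<Delta>) ^ (q + 1)"
        by (intro power_mono) auto
      moreover have "\<bar>F (sel y) z - taylor_poly q (F (sel y)) z y\<bar>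
          \<le> real CARD('n) ^ (q + 1) * \<bar>M\<bar> * norm (z - y) ^ (q + 1)"
      proof (rule taylor_poly_remainder[where g = "F (sel y)" and K = "cball x \<Delta>"])
        show "cont_differentiable (q + 1) (F (sel y))"
          using rep sel unfolding max_representation_def by blast
        show "\<bar>iter_partial is (F (sel y)) u\<bar> \<le> \<bar>M\<bar>" if "length is = q + 1" "u \<in> cball x \<Delta>" for "is" u
          using M[OF sel that(1)] that(2) K by (meson abs_ge_self order_trans subsetD)
      qed (use y z in auto)
      ultimately have "\<bar>F (sel y) z - taylor_poly q (F (sel y)) z y\<bar> \<le> L * \<Delta> ^ (q + 1)"
        unfolding L_def power_mult_distrib mult.assoc[of _ _ "\<Delta> ^ (q + 1)"]
        by (elim order_trans mult_left_mono) simp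
      moreover have "F (sel y) z \<le> f z"
        using rep sel unfolding max_representation_def by blast
      ultimately show ?thesis by linarith
    qed
    then show "cp_model q F sel W z \<le> f z + L * \<Delta> ^ (q + 1)"
      using W unfolding cp_model_def by simp
  qed
qed

text \<open>Passing from \<open>f\<close> to the model and back costs the stopping tolerance at \<open>z\<close> and \<open>\<epsilon>\<close> at \<open>y\<close>;
  in between, \<open>z\<close> minimizes the model.\<close>

lemma subroutine_near_optimal:
  assumes ret: "subroutine_returns f q F sel \<sigma> c x \<Delta> W1 W z"
    and "W \<noteq> {}" and y: "y \<in> cball x \<Delta>" and "cp_model q F sel W y \<le> f y + \<epsilon>"
  shows "f z - f y \<le> \<Delta> powr (real q + \<sigma>) + \<epsilon>"
proof -
  have "cp_model q F sel W z \<le> cp_model q F sel W y"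
    using ret y unfolding subroutine_returns_def cp_solution_def is_arg_min_def by force
  moreover have "f z - cp_model q F sel W z \<le> \<Delta> powr (real q + \<sigma>)"
    using ret unfolding subroutine_returns_def cp_accurate_def by simp
  ultimately show ?thesis using assms(4) by linarith
qed

section \<open>Iterates of the trust-region bundle method\<close>

text \<open>The index \<open>LEAST i. brk j i\<close> identifies the last inner iterate only if the inner loop stops.
  Every step that passes the break test lowers \<open>f\<close> by at least \<open>\<tau> j * \<Delta> j ^ p\<close>, so an endless loop
  would drive \<open>f\<close> below its lower bound \<open>b\<close> on the sublevel set; the same descent keeps all
  iterates in that set.\<close>

lemma trust_region_bundle_step:
  assumes run: "trust_region_bundle_sequence f q p F sel \<sigma> c \<Delta> \<tau> x0 x"
    and pos: "\<And>j. j \<ge> 1 \<Longrightarrow> \<Delta> j > 0" "\<And>j. j \<ge> 1 \<Longrightarrow> \<tau> j > 0"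
    and lower: "\<And>y. f y \<le> f x0 \<Longrightarrow> b \<le> f y"
    and j: "j \<ge> 1"
  shows "f (x j) \<le> f x0 \<and> (\<exists>W z. subroutine_returns f q F sel \<sigma> c (x j) (\<Delta> j) {x j} W z \<and>
    (f (x j) - f z) / \<Delta> j ^ p < \<tau> j)"
proof -
  obtain X W Z and brk :: "nat \<Rightarrow> nat \<Rightarrow> bool" where brk: "\<forall>j i. brk j i \<longleftrightarrow> (f (X j i) - f (Z j i)) / \<Delta> j ^ p < \<tau> j"
    and X0: "X 1 0 = x0"
    and outer: "\<forall>j\<ge>1.
      (\<forall>i. (\<forall>k<i. \<not> brk j k) \<longrightarrow>
         subroutine_returns f q F sel \<sigma> c (X j i) (\<Delta> j) {X j i} (W j i) (Z j i) \<and>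
         (\<not> brk j i \<longrightarrow> X j (i + 1) = Z j i)) \<and>
      x j = X j (LEAST i. brk j i) \<and>
      X (j + 1) 0 = x j"
    using run unfolding trust_region_bundle_sequence_def
    by (elim exE conjE) (rule that; assumption)
  have loop: "subroutine_returns f q F sel \<sigma> c (X j i) (\<Delta> j) {X j i} (W j i) (Z j i)"
      "\<not> brk j i \<Longrightarrow> X j (i + 1) = Z j i"
    if "j \<ge> 1" "\<And>k. k < i \<Longrightarrow> \<not> brk j k" for j i
    using outer that by blast+
  have xj: "x j = X j (LEAST i. brk j i)" and next0: "X (j + 1) 0 = x j" if "j \<ge> 1" for j
    using outer that by blast+
  have descent: "f (X j i) \<le> f (X j 0) - real i * (\<tau> j * \<Delta> j ^ p)"
    if j: "j \<ge> 1" and "\<And>k. k < i \<Longrightarrow> \<not> brk j k" for j i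
    using that(2)
  proof (induction i)
    case (Suc i)
    have "\<not> brk j i" using Suc.prems by simp
    then have "\<tau> j * \<Delta> j ^ p \<le> f (X j i) - f (Z j i)"
      using brk pos(1)[OF j] by (simp add: not_less le_divide_eq)
    moreover have "X j (Suc i) = Z j i"
      using loop(2)[OF j, of i] Suc.prems \<open>\<not> brk j i\<close> by simp
    ultimately show ?case using Suc.IH Suc.prems by (simp add: algebra_simps)
  qed simp
  have terminates: "\<exists>i. brk j i" if j: "j \<ge> 1" and start: "f (X j 0) \<le> f x0" for j
  proof (rule ccontr)
    assume never: "\<nexists>i. brk j i"
    have d: "\<tau> j * \<Delta> j ^ p > 0" using pos j by simp
    then obtain i where i: "real i * (\<tau> j * \<Delta> j ^ p) > f (X j 0) - b"
      using reals_Archimedean3 by blast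
    have "f (X j i) \<le> f (X j 0) - real i * (\<tau> j * \<Delta> j ^ p)"
      using descent[OF j] never by blast
    moreover have "real i * (\<tau> j * \<Delta> j ^ p) \<ge> 0" using d by simp
    ultimately show False using i start lower[of "X j i"] by linarith
  qed
  have last: "\<not> brk j k" if "k < (LEAST i. brk j i)" for j k
    using that by (rule not_less_Least)
  have decrease: "f (x j) \<le> f (X j 0)" if j: "j \<ge> 1" for j
  proof -
    have "f (X j (LEAST i. brk j i)) \<le> f (X j 0) - real (LEAST i. brk j i) * (\<tau> j * \<Delta> j ^ p)"
      using descent[OF j] last by blast
    moreover have "real (LEAST i. brk j i) * (\<tau> j * \<Delta> j ^ p) \<ge> 0"
      using pos[OF j] by simp
    ultimately show ?thesis using xj[OF j] by simp
  qed
  have start: "f (X j 0) \<le> f x0"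
    using j
  proof (induction j rule: dec_induct)
    case base
    then show ?case using X0 by simp
  next
    case (step j)
    then show ?case using decrease[of j] next0[of j] by simp
  qed
  have "brk j (LEAST i. brk j i)"
    using terminates[OF j start] by (rule LeastI_ex)
  moreover have "subroutine_returns f q F sel \<sigma> c (X j (LEAST i. brk j i)) (\<Delta> j)
      {X j (LEAST i. brk j i)} (W j (LEAST i. brk j i)) (Z j (LEAST i. brk j i))"
    using loop(1)[OF j] last by blast
  ultimately show ?thesis
    using brk xj[OF j] decrease[OF j] start by force
qed

text \<open>The bound divides the four-term estimate by \<open>\<Delta> j ^ p\<close>. Of the two remaining powers of
  \<open>\<Delta> j\<close>, the exponent \<open>q - p + \<sigma>\<close> is positive because \<open>\<sigma> > 0\<close>, even for \<open>q = p\<close>.\<close>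

lemma trust_region_bundle_Lambda_quot_vanishes:
  fixes f :: "real^'n::finite \<Rightarrow> real"
  assumes "q \<ge> p"
    and rep: "max_representation q S F f"
    and sel: "\<And>y. sel y \<in> topspace S"
    and bdd: "bounded {y. f y \<le> f x0}"
    and pos: "\<And>j. j \<ge> 1 \<Longrightarrow> \<Delta> j > 0" and \<Delta>: "\<Delta> \<longlonglongrightarrow> 0"
    and pos\<tau>: "\<And>j. j \<ge> 1 \<Longrightarrow> \<tau> j > 0" and \<tau>: "\<tau> \<longlonglongrightarrow> 0"
    and "0 < \<sigma>"
    and run: "trust_region_bundle_sequence f q p F sel \<sigma> c \<Delta> \<tau> x0 x"
  shows "\<exists>B. B \<longlonglongrightarrow> 0 \<and> (\<forall>j\<ge>1. Lambda_quot f p (x j) (\<Delta> j) \<le> B j)"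
proof -
  obtain R where R: "\<And>y. f y \<le> f x0 \<Longrightarrow> norm y \<le> R"
    using bdd unfolding bounded_iff by blast
  obtain D where D: "\<And>j. \<bar>\<Delta> j\<bar> \<le> D"
    using convergent_imp_Bseq[OF convergentI[OF \<Delta>]] unfolding Bseq_def by auto
  \<comment> \<open>Iterates have norm at most \<open>R\<close> and radii are at most \<open>D\<close>, so \<open>K\<close> contains all trust regions.\<close>
  define K :: "(real^'n) set" where "K = cball 0 (R + D)"
  have "compact K" by (simp add: K_def)
  have "x0 \<in> K" using R[of x0] D[of 0] by (simp add: K_def)
  obtain b where b: "is_arg_min f (\<lambda>y. y \<in> K) b"
    using max_representation_attains_inf[OF rep \<open>compact K\<close>] \<open>x0 \<in> K\<close> by blast
  \<comment> \<open>The sublevel set lies in \<open>K\<close>, so the minimum over \<open>K\<close> is a lower bound there.\<close>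
  have lower: "f b \<le> f y" if "f y \<le> f x0" for y
  proof -
    have "y \<in> K" using R[OF that] D[of 0] by (simp add: K_def)
    then show ?thesis using b unfolding is_arg_min_def by (meson not_le)
  qed
  obtain L where L: "\<And>x \<Delta> W z. finite W \<Longrightarrow> W \<noteq> {} \<Longrightarrow> W \<subseteq> cball x \<Delta> \<Longrightarrow> z \<in> cball x \<Delta> \<Longrightarrow>
      cball x \<Delta> \<subseteq> K \<Longrightarrow> cp_model q F sel W z \<le> f z + L * \<Delta> ^ (q + 1)"
    using cp_model_upper_bound[of q S F f sel K, OF rep sel \<open>compact K\<close>] by metis
  define B where "B j = \<tau> j + (\<Delta> j powr (real (q - p) + \<sigma>) + L * \<Delta> j ^ (q - p + 1))" for j
  have "Lambda_quot f p (x j) (\<Delta> j) \<le> B j" if j: "j \<ge> 1" for j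
  proof -
    note d = pos[OF j]
    obtain W z where fx: "f (x j) \<le> f x0"
      and ret: "subroutine_returns f q F sel \<sigma> c (x j) (\<Delta> j) {x j} W z"
      and brk: "(f (x j) - f z) / \<Delta> j ^ p < \<tau> j"
      using trust_region_bundle_step[OF run pos pos\<tau> lower j] by auto
    have W: "finite W \<and> W \<noteq> {} \<and> W \<subseteq> cball (x j) (\<Delta> j)"
      using ret d by (intro subroutine_reaches_base_points) (auto simp: subroutine_returns_def)
    define y where "y = arg_min_on f (cball (x j) (\<Delta> j))"
    obtain y' where "is_arg_min f (\<lambda>y. y \<in> cball (x j) (\<Delta> j)) y'"
      using max_representation_attains_inf[OF rep compact_cball, of "x j" "\<Delta> j"] d
      by (metis cball_eq_empty less_imp_le not_le)
    then have "is_arg_min f (\<lambda>y. y \<in> cball (x j) (\<Delta> j)) y"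
      unfolding y_def arg_min_on_def arg_min_def by (rule someI)
    then have y: "y \<in> cball (x j) (\<Delta> j)"
      by (simp add: is_arg_min_def)
    have "cball (x j) (\<Delta> j) \<subseteq> K"
    proof
      fix u assume "u \<in> cball (x j) (\<Delta> j)"
      then have "norm u \<le> norm (x j) + \<Delta> j"
        using norm_triangle_ineq[of "x j" "u - x j"] by (simp add: dist_norm norm_minus_commute)
      then show "u \<in> K" using R[OF fx] D[of j] by (simp add: K_def)
    qed
    then have "f z - f y \<le> \<Delta> j powr (real q + \<sigma>) + L * \<Delta> j ^ (q + 1)"
      using subroutine_near_optimal[OF ret _ y] L W y by blast
    then have "(f z - f y) / \<Delta> j ^ p \<le> (\<Delta> j powr (real q + \<sigma>) + L * \<Delta> j ^ (q + 1)) / \<Delta> j ^ p"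
      using d by (simp add: divide_right_mono)
    also have "\<dots> = \<Delta> j powr (real (q - p) + \<sigma>) + L * \<Delta> j ^ (q - p + 1)"
    proof -
      have "\<Delta> j powr (real q + \<sigma>) = \<Delta> j powr (real (q - p) + \<sigma>) * \<Delta> j ^ p"
        using d \<open>q \<ge> p\<close> by (simp flip: powr_realpow powr_add)
      moreover have "\<Delta> j ^ (q + 1) = \<Delta> j ^ (q - p + 1) * \<Delta> j ^ p"
        using \<open>q \<ge> p\<close> by (simp flip: power_add)
      ultimately show ?thesis using d by (simp add: add_divide_distrib)
    qed
    finally have "(f (x j) - f z) / \<Delta> j ^ p + (f z - f y) / \<Delta> j ^ p \<le> B j"
      using brk unfolding B_def by linarith
    then show ?thesis
      unfolding Lambda_quot_def y_def[symmetric] by (simp flip: add_divide_distrib)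
  qed
  moreover have "B \<longlonglongrightarrow> 0"
  proof -
    have "(\<lambda>j. \<Delta> j powr (real (q - p) + \<sigma>)) \<longlonglongrightarrow> 0"
    proof (rule tendsto_zero_powrI[OF \<Delta> tendsto_const])
      show "\<forall>\<^sub>F j in sequentially. 0 \<le> \<Delta> j"
        using eventually_ge_at_top[of 1] by eventually_elim (simp add: pos less_imp_le)
    qed (use \<open>0 < \<sigma>\<close> in simp)
    moreover have "(\<lambda>j. L * \<Delta> j ^ (q - p + 1)) \<longlonglongrightarrow> 0"
      using tendsto_mult_left[OF tendsto_power[OF \<Delta>], of L "q - p + 1"] by simp
    ultimately show ?thesis
      using tendsto_add[OF \<tau> tendsto_add] unfolding B_def by fastforce
  qed
  ultimately show ?thesis by blast
qed

section \<open>Accumulation points with property (P)\<close>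

theorem corollary3p1:
  fixes f :: "real^'n \<Rightarrow> real"
    and S :: "'s topology"
    and F :: "'s \<Rightarrow> real^'n \<Rightarrow> real"
    and sel :: "real^'n \<Rightarrow> 's"
    and q p :: nat
    and \<sigma> c :: real
    and \<Delta> \<tau> :: "nat \<Rightarrow> real"
    and x0 xstar :: "real^'n"
    and x :: "nat \<Rightarrow> real^'n"
  assumes "p \<ge> 1" and "q \<ge> p"
    and "max_representation q S F f"
    and "\<And>y. sel y \<in> active_set S F f y"
    and "bounded {y. f y \<le> f x0}"
    and "\<And>j. j \<ge> 1 \<Longrightarrow> \<Delta> j > 0" and "\<Delta> \<longlonglongrightarrow> 0"
    and "\<And>j. j \<ge> 1 \<Longrightarrow> \<tau> j > 0" and "\<tau> \<longlonglongrightarrow> 0"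
    and "0 < \<sigma>" and "\<sigma> < 1" and "c > 0"
    and "trust_region_bundle_sequence f q p F sel \<sigma> c \<Delta> \<tau> x0 x"
    and "\<exists>r. strict_mono r \<and> (x \<circ> r) \<longlonglongrightarrow> xstar"
    and "property_P f p xstar"
  shows "infinite {j. j \<ge> 1 \<and> xstar \<in> cball (x j) (\<Delta> j)}"
proof
  assume "finite {j. j \<ge> 1 \<and> xstar \<in> cball (x j) (\<Delta> j)}"
  then obtain N where N: "\<And>j. j \<ge> 1 \<Longrightarrow> xstar \<in> cball (x j) (\<Delta> j) \<Longrightarrow> j < N"
    unfolding finite_nat_set_iff_bounded by blast
  have "sel y \<in> topspace S" for y
    using assms(4)[of y] by (simp add: active_set_def)
  then obtain B where B: "B \<longlonglongrightarrow> 0" "\<And>j. j \<ge> 1 \<Longrightarrow> Lambda_quot f p (x j) (\<Delta> j) \<le> B j"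
    using trust_region_bundle_Lambda_quot_vanishes[OF assms(2,3) _ assms(5-10) assms(13)] by blast
  obtain U C where U: "open U" "xstar \<in> U" and "C > 0"
    and P: "\<And>x \<Delta>. x \<in> U \<Longrightarrow> \<Delta> > 0 \<Longrightarrow> xstar \<notin> cball x \<Delta> \<Longrightarrow> Lambda_quot f p x \<Delta> \<ge> C"
    using assms(15) unfolding property_P_def by blast
  obtain r where r: "strict_mono r" "(x \<circ> r) \<longlonglongrightarrow> xstar" using assms(14) by blast
  have "\<forall>\<^sub>F k in sequentially. x (r k) \<in> U"
    using topological_tendstoD[OF r(2) U] by simp
  moreover have "\<forall>\<^sub>F k in sequentially. B (r k) < C"
    using order_tendstoD(2)[OF LIMSEQ_subseq_LIMSEQ[OF B(1) r(1)] \<open>C > 0\<close>] by simp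
  moreover have "\<forall>\<^sub>F k in sequentially. k \<ge> max 1 N"
    by (rule eventually_ge_at_top)
  ultimately have "\<forall>\<^sub>F k in sequentially. False"
  proof eventually_elim
    case (elim k)
    have k: "r k \<ge> 1" "r k \<ge> N" using elim(3) seq_suble[OF r(1), of k] by linarith+
    then have "Lambda_quot f p (x (r k)) (\<Delta> (r k)) \<ge> C"
      using P elim(1) assms(6) N by (meson leD)
    then show ?case using B(2)[OF k(1)] elim(2) by linarith
  qed
  then show False by simp
qed

end
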